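(* Let $\mathbb{F}$ be an arbitrary field and $p\in\mathbb{F}[x]$ a monic irreducible polynomial with $\deg(p)=s$. Let $W$ be the generalized Weyr matrix associated with $p$ and the generalized Segre characteristic $\alpha=(\alpha_1,\ldots,\alpha_m)$, and let $\tau=(\tau_1,\ldots,\tau_{\alpha_1})$ be the conjugate partition of $\alpha$. Let $K\in Z(W)$ be partitioned as $K=[K_{i,j}]_{i,j=1,\ldots,\alpha_1}$ with $K_{i,j}\in M_{s\tau_i\times s\tau_j}(\mathbb{F})$. Then $K$ is block upper triangular and $$\det(K)=\det(K_{1,1})\det(K_{2,2})\cdots\det(K_{\alpha_1,\alpha_1}).$$
   Context: For a square matrix $A\in M_n(\mathbb{F})$, $Z(A)=\{B\in M_n(\mathbb{F}): AB=BA\}$ is the centralizer of $A$. Let $p=x^s+c_{s-1}x^{s-1}+\cdots+c_1x+c_0\in\mathbb{F}[x]$. Its companion matrix $C\in M_s(\mathbb{F})$ has ones on the first subdiagonal, last column $(-c_0,-c_1,\ldots,-c_{s-1})^T$, and zeros elsewhere. $E\in M_s(\mathbb{F})$ is the matrix whose only nonzero entry is a $1$ in position $(1,s)$. A generalized Segre characteristic is a sequence of integers $\alpha_1\ge\alpha_2\ge\cdots\ge\alpha_m\ge0$; its conjugate partition is $\tau=(\tau_1,\ldots,\tau_{\alpha_1})$, $\tau_i=\#\{j:\alpha_j\ge i\}$. The associated generalized Weyr matrix is the $\alpha_1\times\alpha_1$ block upper bidiagonal matrix $W$ with diagonal blocks $W_i=\mathrm{diag}(C,\ldots,C)\in M_{s\tau_i}(\mathbb{F})$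 ($i=1,\ldots,\alpha_1$), superdiagonal blocks (in block position $(i,i+1)$) $E_{i+1}=\begin{bmatrix}\mathrm{diag}(E,\ldots,E)\\0\end{bmatrix}\in M_{s\tau_i\times s\tau_{i+1}}(\mathbb{F})$ with $\tau_{i+1}$ copies of $E$ ($i=1,\ldots,\alpha_1-1$), and zeros elsewhere. *)

theory Defs
  imports
    "HOL-Computational_Algebra.Polynomial_Factorial"
    "Jordan_Normal_Form.Determinant"
begin

(* All indices are shifted to start at 0: list entry (tau ! i) and block (i,j)
   here are tau_(i+1) and block (i+1,j+1) in the usual 1-based notation. *)

definition centralizer :: "'a::semiring_0 mat \<Rightarrow> 'a mat set" where
  "centralizer A = {B \<in> carrier_mat (dim_row A) (dim_row A). A * B = B * A}"

(* A monic p = x^s + c_(s-1) x^(s-1) + ... + c_0 is assumed; leading coefficient is not used. *)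
definition companion_mat :: "'a::comm_ring_1 poly \<Rightarrow> 'a mat" where
  "companion_mat p = (let s = degree p in
     mat s s (\<lambda>(i, j). if j = s - 1 then - coeff p i else if i = j + 1 then 1 else 0))"

definition corner_mat :: "nat \<Rightarrow> 'a::zero_neq_one mat" where
  "corner_mat s = mat s s (\<lambda>(i, j). if i = 0 \<and> j = s - 1 then 1 else 0)"

definition segre_characteristic :: "nat list \<Rightarrow> bool" where
  "segre_characteristic \<alpha> \<longleftrightarrow> \<alpha> \<noteq> [] \<and> sorted_wrt (\<ge>) \<alpha>"

definition conjugate_partition :: "nat list \<Rightarrow> nat list" where
  "conjugate_partition \<alpha> = map (\<lambda>i. card {j. j < length \<alpha> \<and> i \<le> \<alpha> ! j}) [1..<hd \<alpha> + 1]"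


section \<open>Square matrices partitioned into blocks of sizes \<open>ns ! i \<times> ns ! j\<close>\<close>

definition block_start :: "nat list \<Rightarrow> nat \<Rightarrow> nat" where
  "block_start ns i = sum_list (take i ns)"

definition get_block :: "nat list \<Rightarrow> 'a mat \<Rightarrow> nat \<Rightarrow> nat \<Rightarrow> 'a mat" where
  "get_block ns A i j =
     mat (ns ! i) (ns ! j) (\<lambda>(a, b). A $$ (block_start ns i + a, block_start ns j + b))"

(* the block row (or column) that contains row (or column) r *)
definition block_index :: "nat list \<Rightarrow> nat \<Rightarrow> nat" where
  "block_index ns r = (LEAST i. r < block_start ns (Suc i))"

definition mat_of_blocks :: "nat list \<Rightarrow> (nat \<Rightarrow> nat \<Rightarrow> 'a mat) \<Rightarrow> 'a mat" where
  "mat_of_blocks ns B = mat (sum_list ns) (sum_list ns) (\<lambda>(r, c).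
     let i = block_index ns r; j = block_index ns c
     in B i j $$ (r - block_start ns i, c - block_start ns j))"

lemma block_start_mono: "i \<le> j \<Longrightarrow> block_start ns i \<le> block_start ns j"
  unfolding block_start_def
  by (metis le_add1 le_add_diff_inverse sum_list_append take_add)

lemma block_start_Suc: "i < length ns \<Longrightarrow> block_start ns (Suc i) = block_start ns i + ns ! i"
  by (simp add: block_start_def take_Suc_conv_app_nth)

lemma block_start_length: "block_start ns (length ns) = sum_list ns"
  by (simp add: block_start_def)

lemma block_start_add_less:
  assumes "i < length ns" "a < ns ! i"
  shows "block_start ns i + a < sum_list ns"
proof -
  have "block_start ns i + a < block_start ns (Suc i)"
    using assms by (simp add: block_start_Suc)
  also have "\<dots> \<le> block_start ns (length ns)"
    using assms by (intro block_start_mono) simp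
  finally show ?thesis by (simp add: block_start_length)
qed

lemma block_index_eq:
  assumes "i < length ns" "a < ns ! i"
  shows "block_index ns (block_start ns i + a) = i"
  unfolding block_index_def
proof (rule Least_equality)
  show "block_start ns i + a < block_start ns (Suc i)"
    using assms by (simp add: block_start_Suc)
next
  fix k assume k: "block_start ns i + a < block_start ns (Suc k)"
  show "i \<le> k"
  proof (rule ccontr)
    assume "\<not> i \<le> k"
    then have "block_start ns (Suc k) \<le> block_start ns i"
      by (intro block_start_mono) simp
    with k show False by simp
  qed
qed

lemma get_block_mat_of_blocks:
  assumes "i < length ns" "j < length ns" "B i j \<in> carrier_mat (ns ! i) (ns ! j)"
  shows "get_block ns (mat_of_blocks ns B) i j = B i j"
  using assms
  by (intro eq_matI)
     (auto simp: get_block_def mat_of_blocks_def block_index_eq block_start_add_less)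


section \<open>The generalized Weyr matrix\<close>

definition weyr_block_sizes :: "'a::field poly \<Rightarrow> nat list \<Rightarrow> nat list" where
  "weyr_block_sizes p \<alpha> = map (\<lambda>t. degree p * t) (conjugate_partition \<alpha>)"

definition weyr_block :: "'a::field poly \<Rightarrow> nat list \<Rightarrow> nat \<Rightarrow> nat \<Rightarrow> 'a mat" where
  "weyr_block p \<alpha> i j = (let s = degree p; \<tau> = conjugate_partition \<alpha> in
     if j = i then diag_block_mat (replicate (\<tau> ! i) (companion_mat p))
     else if j = i + 1 then
       diag_block_mat (replicate (\<tau> ! j) (corner_mat s)) @\<^sub>r
       0\<^sub>m (s * (\<tau> ! i - \<tau> ! j)) (s * \<tau> ! j)
     else 0\<^sub>m (s * \<tau> ! i) (s * \<tau> ! j))"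

definition generalized_weyr_mat :: "'a::field poly \<Rightarrow> nat list \<Rightarrow> 'a mat" where
  "generalized_weyr_mat p \<alpha> = mat_of_blocks (weyr_block_sizes p \<alpha>) (weyr_block p \<alpha>)"

lemma length_conjugate_partition [simp]: "length (conjugate_partition \<alpha>) = hd \<alpha>"
  by (simp add: conjugate_partition_def)

lemma conjugate_partition_antimono:
  assumes "i \<le> j" "j < hd \<alpha>"
  shows "conjugate_partition \<alpha> ! j \<le> conjugate_partition \<alpha> ! i"
  using assms unfolding conjugate_partition_def
  by (auto simp del: upt_Suc intro!: card_mono)

lemma weyr_block_carrier:
  assumes "i < hd \<alpha>" "j < hd \<alpha>"
  shows "weyr_block p \<alpha> i j \<in>
    carrier_mat (weyr_block_sizes p \<alpha> ! i) (weyr_block_sizes p \<alpha> ! j)"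
proof -
  have "degree p * conjugate_partition \<alpha> ! j
      + degree p * (conjugate_partition \<alpha> ! i - conjugate_partition \<alpha> ! j)
      = degree p * conjugate_partition \<alpha> ! i" if "j = Suc i"
    using conjugate_partition_antimono[of i j \<alpha>] assms that
    by (simp flip: distrib_left)
  then show ?thesis
    using assms
    by (auto simp: weyr_block_def weyr_block_sizes_def Let_def append_rows_def
        dim_diag_block_mat companion_mat_def corner_mat_def sum_list_replicate mult.commute
        intro!: carrier_matI)
qed

lemma get_block_generalized_weyr_mat:
  assumes "i < hd \<alpha>" "j < hd \<alpha>"
  shows "get_block (weyr_block_sizes p \<alpha>) (generalized_weyr_mat p \<alpha>) i j = weyr_block p \<alpha> i j"
  using assms weyr_block_carrier[OF assms, of p] unfolding generalized_weyr_mat_def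
  by (intro get_block_mat_of_blocks) (simp_all add: weyr_block_sizes_def)

end

theory Submission
  imports Defs
begin

text \<open>
  Everything follows from the shape of the matrix \<open>N = p(W)\<close>. Index the standard basis by triples
  \<open>(i, t, k)\<close>: block \<open>i\<close>, cell \<open>t < \<tau>_i\<close> inside that block, and offset \<open>k < s\<close> inside the cell, with
  blocks counted from 0. The companion blocks make \<open>W\<close> send \<open>e(i,t,k)\<close> to \<open>e(i,t,k+1)\<close> for
  \<open>k < s - 1\<close>, and the last vector \<open>e(i,t,s-1)\<close> of a cell to
  \<open>e(i-1,t,0) - (c_0 e(i,t,0) + ... + c_(s-1) e(i,t,s-1))\<close>, where \<open>e(-1,t,0) = 0\<close>; the term in
  block \<open>i - 1\<close> is the contribution of the corner matrix. Hence \<open>W^k e(i,t,0) = e(i,t,k)\<close>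
  for \<open>k < s\<close>, and the lower coefficients of \<open>p\<close> cancel exactly:
  \<open>N e(i,t,0) = e(i-1,t,0)\<close> (\<open>poly_mat_W_cell\<close>). Since \<open>N\<close> commutes with \<open>W^k\<close>, also
  \<open>N e(i,t,k) = e(i-1,t,k)\<close> (\<open>col_poly_mat_W\<close>). So \<open>N\<close> just moves every block to the previous one,
  keeping positions inside the block; it is the nilpotent Weyr matrix with every entry inflated to an
  \<open>s \<times> s\<close> scalar block.

  A matrix \<open>K\<close> that commutes with \<open>W\<close> commutes with \<open>N\<close>. Comparing entries of \<open>N K = K N\<close> says that
  an entry of \<open>K\<close> in block \<open>(i+1, j)\<close> equals the entry at the same inner position of block \<open>(i, j-1)\<close>,
  or 0 if \<open>j = 0\<close> (\<open>commute_W_shift\<close>). Walking a block below the diagonal up and to the left ends in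
  block column 0 below the diagonal, where all entries vanish; thus \<open>K\<close> is block upper triangular.
  The determinant formula then holds for every block upper triangular matrix
  (\<open>det_block_upper_triangular\<close>).
\<close>

section \<open>Evaluating a polynomial at a square matrix\<close>

text \<open>
  The partial sums are kept as an object of their own because \<open>poly_mat_W_cell\<close> needs the sum
  without its leading term: up to degree \<open>s - 1\<close> the powers of \<open>W\<close> stay inside one cell, and only
  the top power leaves it.
\<close>

fun poly_mat_upto :: "'a::comm_ring_1 poly \<Rightarrow> 'a mat \<Rightarrow> nat \<Rightarrow> 'a mat" where
  "poly_mat_upto p A 0 = 0\<^sub>m (dim_row A) (dim_row A)"
| "poly_mat_upto p A (Suc k) = poly_mat_upto p A k + coeff p k \<cdot>\<^sub>m (A ^\<^sub>m k)"

definition poly_mat :: "'a::comm_ring_1 poly \<Rightarrow> 'a mat \<Rightarrow> 'a mat" where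
  "poly_mat p A = poly_mat_upto p A (Suc (degree p))"

lemma poly_mat_upto_carrier [simp]:
  "A \<in> carrier_mat n n \<Longrightarrow> poly_mat_upto p A k \<in> carrier_mat n n"
  by (induction k) auto

lemma poly_mat_carrier [simp]:
  "A \<in> carrier_mat n n \<Longrightarrow> poly_mat p A \<in> carrier_mat n n"
  by (simp add: poly_mat_def del: poly_mat_upto.simps)

lemma pow_mat_commute:
  fixes A B :: "'a::semiring_1 mat"
  assumes A: "A \<in> carrier_mat n n" and B: "B \<in> carrier_mat n n" and AB: "A * B = B * A"
  shows "A ^\<^sub>m k * B = B * A ^\<^sub>m k"
proof (induction k)
  case (Suc k)
  have Ak: "A ^\<^sub>m k \<in> carrier_mat n n" using A by simp
  have "A ^\<^sub>m k * A * B = A ^\<^sub>m k * (B * A)"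
    using assoc_mult_mat[OF Ak A B] AB by simp
  also have "\<dots> = B * (A ^\<^sub>m k * A)"
    using assoc_mult_mat[OF Ak B A] assoc_mult_mat[OF B Ak A] Suc by simp
  finally show ?case by simp
qed (use A B in simp)

lemma poly_mat_upto_commute:
  assumes A: "A \<in> carrier_mat n n" and B: "B \<in> carrier_mat n n" and AB: "A * B = B * A"
  shows "poly_mat_upto p A k * B = B * poly_mat_upto p A k"
proof (induction k)
  case (Suc k)
  have Ak: "A ^\<^sub>m k \<in> carrier_mat n n" using A by simp
  show ?case
    using Suc pow_mat_commute[OF A B AB, of k] A B Ak
    by (simp add: add_mult_distrib_mat[where nr=n and n=n and nc=n]
        mult_add_distrib_mat[where nr=n and n=n and nc=n]
        mult_smult_assoc_mat[where nr=n and n=n and nc=n]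
        mult_smult_distrib[where nr=n and n=n and nc=n])
qed (use A B in simp)

lemma poly_mat_commute:
  assumes "A \<in> carrier_mat n n" "B \<in> carrier_mat n n" "A * B = B * A"
  shows "poly_mat p A * B = B * poly_mat p A"
  using poly_mat_upto_commute[OF assms] by (simp add: poly_mat_def del: poly_mat_upto.simps)

lemma mat_mult_unit_vec:
  fixes A :: "'a::semiring_1 mat"
  assumes "A \<in> carrier_mat m n" "r < n"
  shows "A *\<^sub>v unit_vec n r = col A r"
  using assms by (intro eq_vecI) (auto simp: scalar_prod_right_unit)


lemma smult_mat_mult_vec:
  fixes A :: "'a::comm_ring_1 mat"
  assumes "A \<in> carrier_mat m n" "v \<in> carrier_vec n"
  shows "(c \<cdot>\<^sub>m A) *\<^sub>v v = c \<cdot>\<^sub>v (A *\<^sub>v v)"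
  using assms by (intro eq_vecI) auto


section \<open>Block coordinates\<close>

lemma block_coordinates:
  assumes "r < sum_list ns"
  obtains i a where "i < length ns" "a < ns ! i" "r = block_start ns i + a"
proof -
  define i where "i = block_index ns r"
  \<comment> \<open>the last block witnesses that the minimum defining the block index exists\<close>
  have ex: "r < block_start ns (Suc (length ns - 1))"
    using assms by (cases ns) (simp_all add: block_start_def)
  have r: "r < block_start ns (Suc i)"
    unfolding i_def block_index_def by (rule LeastI[of _ "length ns - 1"]) (rule ex)
  have "i \<le> length ns - 1"
    unfolding i_def block_index_def by (rule Least_le) (rule ex)
  moreover have "ns \<noteq> []" using assms by auto
  ultimately have i: "i < length ns" by (cases ns) auto
  have "block_start ns i \<le> r"
  proof (cases i)
    case (Suc i')
    then show ?thesis
      using not_less_Least[of i' "\<lambda>i. r < block_start ns (Suc i)"]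
      unfolding i_def block_index_def by simp
  qed (simp add: block_start_def)
  with r i that[of i "r - block_start ns i"] show thesis
    by (simp add: block_start_Suc)
qed

lemma block_coordinates_eq_iff:
  assumes "i < length ns" "a < ns ! i" "j < length ns" "b < ns ! j"
  shows "block_start ns i + a = block_start ns j + b \<longleftrightarrow> i = j \<and> a = b"
  using block_index_eq[OF assms(1,2)] block_index_eq[OF assms(3,4)] by auto

lemma get_block_index:
  "a < ns ! i \<Longrightarrow> b < ns ! j \<Longrightarrow>
   get_block ns A i j $$ (a, b) = A $$ (block_start ns i + a, block_start ns j + b)"
  by (simp add: get_block_def)

lemma div_mod_eq_iff:
  fixes a s t k :: nat
  assumes "k < s"
  shows "a div s = t \<and> a mod s = k \<longleftrightarrow> a = s * t + k"
  using assms mult_div_mod_eq[of s a] by (auto simp del: mult_div_mod_eq)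

lemma index_diag_block_mat_replicate:
  assumes "A \<in> carrier_mat s s" "a < s * k" "b < s * k"
  shows "diag_block_mat (replicate k A) $$ (a, b) =
    (if a div s = b div s then A $$ (a mod s, b mod s) else 0)"
  using assms
proof (induction k arbitrary: a b)
  case (Suc k)
  have s: "s > 0" using Suc.prems by (cases s) auto
  have dim: "dim_row (diag_block_mat (replicate k A)) = s * k"
    "dim_col (diag_block_mat (replicate k A)) = s * k"
    using Suc.prems by (simp_all add: dim_diag_block_mat sum_list_replicate mult.commute)
  have div: "x div s = Suc ((x - s) div s)" "x mod s = (x - s) mod s" if "s \<le> x" for x
    using that s by (simp_all add: le_div_geq le_mod_geq)
  have "\<not> s \<le> a \<Longrightarrow> a < s" "\<not> s \<le> b \<Longrightarrow> b < s" by simp_all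
  then show ?case
    using Suc.prems Suc.IH[of "a - s" "b - s"] div[of a] div[of b]
    by (cases "s \<le> a"; cases "s \<le> b") (simp_all add: dim Let_def)
qed simp

text \<open>
  Splitting off the first block row and column leaves a block upper triangular matrix for the
  remaining sizes, with zeros to the left of it.
\<close>

lemma det_block_upper_triangular:
  fixes A :: "'a::idom mat"
  assumes "A \<in> carrier_mat (sum_list ns) (sum_list ns)"
    and "\<And>i j. i < length ns \<Longrightarrow> j < i \<Longrightarrow> get_block ns A i j = 0\<^sub>m (ns ! i) (ns ! j)"
  shows "det A = (\<Prod>i<length ns. det (get_block ns A i i))"
  using assms
proof (induction ns arbitrary: A)
  case Nil
  then show ?case by simp
next
  case (Cons m ns)
  obtain A1 A2 A3 A4 where sp: "split_block A m m = (A1, A2, A3, A4)"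
    by (metis prod_cases4)
  have dims: "dim_row A = m + sum_list ns" "dim_col A = m + sum_list ns"
    using Cons.prems(1) by auto
  note S = split_block[OF sp dims]
  have A4: "A4 = mat (sum_list ns) (sum_list ns) (\<lambda>(i, j). A $$ (i + m, j + m))"
    and A1: "A1 = mat m m (\<lambda>ij. A $$ ij)"
    and A3: "A3 = mat (sum_list ns) m (\<lambda>(i, j). A $$ (i + m, j))"
    using sp dims unfolding split_block_def Let_def by auto
  have start: "block_start (m # ns) (Suc i) = m + block_start ns i"
    "block_start (m # ns) 0 = 0" for i
    by (simp_all add: block_start_def)
  have block: "get_block (m # ns) A (Suc i) (Suc j) = get_block ns A4 i j"
    if ij: "i < length ns" "j < length ns" for i j
  proof (rule eq_matI)
    fix a b assume "a < dim_row (get_block ns A4 i j)" "b < dim_col (get_block ns A4 i j)"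
    then have ab: "a < ns ! i" "b < ns ! j" by (simp_all add: get_block_def)
    have "block_start ns i + a < sum_list ns" "block_start ns j + b < sum_list ns"
      using ij ab by (simp_all add: block_start_add_less)
    then show "get_block (m # ns) A (Suc i) (Suc j) $$ (a, b) = get_block ns A4 i j $$ (a, b)"
      using ab by (simp add: get_block_index start A4 add_ac)
  qed (simp_all add: get_block_def)
  have A3_0: "A3 = 0\<^sub>m (sum_list ns) m"
  proof (rule eq_matI)
    fix r c
    assume "r < dim_row (0\<^sub>m (sum_list ns) m)" "c < dim_col (0\<^sub>m (sum_list ns) m)"
    then have r: "r < sum_list ns" and c: "c < m" by auto
    obtain i a where ia: "i < length ns" "a < ns ! i" "r = block_start ns i + a"
      using block_coordinates[OF r] .
    have "get_block (m # ns) A (Suc i) 0 $$ (a, c) = 0"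
      using Cons.prems(2)[of "Suc i" 0] ia c by simp
    then show "A3 $$ (r, c) = 0\<^sub>m (sum_list ns) m $$ (r, c)"
      using ia c r by (simp add: A3 get_block_index start add_ac)
  qed (simp_all add: A3)
  have "get_block ns A4 i j = 0\<^sub>m (ns ! i) (ns ! j)" if "i < length ns" "j < i" for i j
    using Cons.prems(2)[of "Suc i" "Suc j"] block[of i j] that by simp
  then have IH: "det A4 = (\<Prod>i<length ns. det (get_block ns A4 i i))"
    using Cons.IH[OF S(4)] by blast
  have "get_block (m # ns) A 0 0 = A1"
    by (simp add: get_block_def A1 start cong: cong_mat)
  moreover have "det A = det A1 * det A4"
    using det_four_block_mat_lower_left_zero[OF S(1,2) A3_0 S(4)] S(5) by simp
  moreover have "(\<Prod>i<length ns. det (get_block ns A4 i i)) =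
      (\<Prod>i<length ns. det (get_block (m # ns) A (Suc i) (Suc i)))"
    by (intro prod.cong) (simp_all add: block)
  ultimately show ?case
    using IH by (simp add: prod.lessThan_Suc_shift del: prod.lessThan_Suc)
qed


section \<open>The value of \<open>p\<close> at the generalized Weyr matrix\<close>

lemma length_weyr_block_sizes [simp]: "length (weyr_block_sizes p \<alpha>) = hd \<alpha>"
  by (simp add: weyr_block_sizes_def)

lemma nth_weyr_block_sizes [simp]:
  "i < hd \<alpha> \<Longrightarrow> weyr_block_sizes p \<alpha> ! i = degree p * conjugate_partition \<alpha> ! i"
  by (simp add: weyr_block_sizes_def)

lemma generalized_weyr_mat_carrier [simp]:
  "generalized_weyr_mat p \<alpha> \<in>
     carrier_mat (sum_list (weyr_block_sizes p \<alpha>)) (sum_list (weyr_block_sizes p \<alpha>))"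
  by (simp add: generalized_weyr_mat_def mat_of_blocks_def)

text \<open>
  Both kinds of nonzero blocks connect only cells with the same number: the diagonal ones by
  construction, and the superdiagonal ones because their zero padding sits below the last
  corner matrix. This is why a single condition on \<open>div\<close> covers all cases.
\<close>

lemma generalized_weyr_mat_index:
  fixes p :: "'a::field poly" and \<alpha> :: "nat list"
  defines "s \<equiv> degree p" and "ns \<equiv> weyr_block_sizes p \<alpha>"
  assumes i: "i < hd \<alpha>" "a < ns ! i" and j: "j < hd \<alpha>" "b < ns ! j"
  shows "generalized_weyr_mat p \<alpha> $$ (block_start ns i + a, block_start ns j + b) =
    (if a div s \<noteq> b div s then 0
     else if j = i then companion_mat p $$ (a mod s, b mod s)
     else if j = Suc i then corner_mat s $$ (a mod s, b mod s) else 0)"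
proof -
  have b: "b < s * conjugate_partition \<alpha> ! j" and a: "a < s * conjugate_partition \<alpha> ! i"
    using i j by (simp_all add: ns_def s_def)
  have C: "companion_mat p \<in> carrier_mat s s" "(corner_mat s :: 'a mat) \<in> carrier_mat s s"
    by (simp_all add: companion_mat_def corner_mat_def Let_def s_def)
  have "generalized_weyr_mat p \<alpha> $$ (block_start ns i + a, block_start ns j + b)
      = weyr_block p \<alpha> i j $$ (a, b)"
    using get_block_generalized_weyr_mat[OF i(1) j(1), of p]
      get_block_index[OF i(2) j(2), of "generalized_weyr_mat p \<alpha>"] by (simp add: ns_def)
  also have "\<dots> = (if a div s \<noteq> b div s then 0
     else if j = i then companion_mat p $$ (a mod s, b mod s)
     else if j = Suc i then corner_mat s $$ (a mod s, b mod s) else 0)"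
  proof -
    consider "j = i" | "j = Suc i" | "j \<noteq> i" "j \<noteq> Suc i" by blast
    then show ?thesis
    proof cases
      case 1
      then show ?thesis
        using a b C by (simp add: weyr_block_def Let_def index_diag_block_mat_replicate flip: s_def)
    next
      case 2
      let ?t = "conjugate_partition \<alpha> ! j"
      have le: "?t \<le> conjugate_partition \<alpha> ! i"
        using 2 j by (intro conjugate_partition_antimono) auto
      have "s * ?t + s * (conjugate_partition \<alpha> ! i - ?t) = s * conjugate_partition \<alpha> ! i"
        using le by (simp flip: distrib_left)
      moreover have "dim_row (diag_block_mat (replicate ?t (corner_mat s :: 'a mat))) = s * ?t"
        "dim_col (diag_block_mat (replicate ?t (corner_mat s :: 'a mat))) = s * ?t"
        using C by (simp_all add: dim_diag_block_mat sum_list_replicate mult.commute)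
      \<comment> \<open>a row of the zero padding lies in a cell beyond all cells of block column \<open>j\<close>\<close>
      moreover have "a div s \<noteq> b div s" if "\<not> a < s * ?t"
      proof -
        have "s > 0" using b by (cases s) auto
        then have "b div s < ?t" using b by (simp add: less_mult_imp_div_less mult.commute)
        moreover have "?t \<le> a div s"
          using that \<open>s > 0\<close> by (simp add: less_eq_div_iff_mult_less_eq mult.commute)
        ultimately show ?thesis by simp
      qed
      ultimately show ?thesis
        using 2 a b C
        by (auto simp: weyr_block_def Let_def index_diag_block_mat_replicate append_rows_def
            simp flip: s_def)
    next
      case 3
      then show ?thesis using a b by (simp add: weyr_block_def Let_def flip: s_def)
    qed
  qed
  finally show ?thesis .
qed

context
  fixes p :: "'a::field poly" and \<alpha> :: "nat list" and s n :: nat and ns \<tau> :: "nat list"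
    and W :: "'a mat" and e :: "nat \<Rightarrow> 'a vec"
  defines "s \<equiv> degree p" and "ns \<equiv> weyr_block_sizes p \<alpha>" and "\<tau> \<equiv> conjugate_partition \<alpha>"
    and "n \<equiv> sum_list ns"
    and "W \<equiv> generalized_weyr_mat p \<alpha>" and "e \<equiv> unit_vec n"
begin

lemma W_carrier: "W \<in> carrier_mat n n"
  by (simp add: W_def n_def ns_def)

lemma \<tau>_antimono: "Suc i < hd \<alpha> \<Longrightarrow> \<tau> ! Suc i \<le> \<tau> ! i"
  unfolding \<tau>_def by (rule conjugate_partition_antimono) simp_all

lemma ns_antimono: "Suc i < hd \<alpha> \<Longrightarrow> ns ! Suc i \<le> ns ! i"
  using \<tau>_antimono[of i] by (simp add: ns_def \<tau>_def)

lemma cell_less: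
  assumes "t < \<tau> ! j" "k < s" "j < hd \<alpha>"
  shows "s * t + k < ns ! j"
proof -
  have "s * t + k < s * Suc t" using assms by simp
  also have "\<dots> \<le> s * \<tau> ! j" using assms by (intro mult_le_mono2) simp
  finally show ?thesis using assms by (simp add: ns_def s_def \<tau>_def)
qed

lemma W_shift:
  assumes j: "j < hd \<alpha>" "t < \<tau> ! j" and k: "Suc k < s"
  shows "W *\<^sub>v e (block_start ns j + (s * t + k)) = e (block_start ns j + (s * t + Suc k))"
proof -
  have b: "s * t + k < ns ! j" "s * t + Suc k < ns ! j" using cell_less[of t j k] cell_less[of t j "Suc k"] j k by simp_all
  have lt: "block_start ns j + (s * t + k) < n" "block_start ns j + (s * t + Suc k) < n"
    using block_start_add_less[of j ns "s * t + k"] block_start_add_less[of j ns "s * t + Suc k"]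
      b j by (simp_all add: n_def ns_def)
  have "col W (block_start ns j + (s * t + k)) = e (block_start ns j + (s * t + Suc k))"
  proof (rule eq_vecI)
    fix r assume "r < dim_vec (e (block_start ns j + (s * t + Suc k)))"
    then have r: "r < n" by (simp add: e_def)
    then obtain i a where ia: "i < length ns" "a < ns ! i" "r = block_start ns i + a"
      unfolding n_def by (rule block_coordinates)
    have i: "i < hd \<alpha>" using ia by (simp add: ns_def)
    have "a div s = t \<and> a mod s = Suc k \<longleftrightarrow> a = s * t + Suc k"
      using k by (rule div_mod_eq_iff)
    moreover have "a mod s < s" using k by simp
    ultimately have "W $$ (r, block_start ns j + (s * t + k)) =
        (if i = j \<and> a = s * t + Suc k then 1 else 0)"
      using generalized_weyr_mat_index[of i \<alpha> a p j "s * t + k", folded ns_def s_def W_def]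
        i ia b j k
      by (auto simp: companion_mat_def corner_mat_def Let_def simp flip: s_def)
    also have "\<dots> = (if r = block_start ns j + (s * t + Suc k) then 1 else 0)"
      using block_coordinates_eq_iff[of i ns a j "s * t + Suc k"] ia b j by (simp add: ns_def)
    finally show "col W (block_start ns j + (s * t + k)) $ r =
        e (block_start ns j + (s * t + Suc k)) $ r"
      using W_carrier r lt by (simp add: e_def)
  qed (use W_carrier in \<open>simp add: e_def\<close>)
  then show ?thesis using mat_mult_unit_vec[OF W_carrier lt(1)] by (simp add: e_def)
qed

text \<open>
  For the first position \<open>b\<close> of a cell this is
  \<open>c_0 e(b) + c_1 e(b+1) + ... + c_(k-1) e(b+k-1)\<close>.
\<close>

definition chain_sum :: "nat \<Rightarrow> nat \<Rightarrow> 'a vec" where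
  "chain_sum b k = vec n (\<lambda>r. if b \<le> r \<and> r < b + k then coeff p (r - b) else 0)"

text \<open>
  The last column of a companion matrix contributes the negated coefficients of \<open>p\<close>, and the corner
  matrix above it a single 1 at the start of the same cell in the previous block.
\<close>

lemma W_wrap:
  assumes j: "j < hd \<alpha>" "t < \<tau> ! j" and s: "s > 0"
  shows "W *\<^sub>v e (block_start ns j + (s * t + (s - 1))) =
    (if j = 0 then 0\<^sub>v n else e (block_start ns (j - 1) + s * t))
      - chain_sum (block_start ns j + s * t) s"
    (is "_ = ?v - ?w")
proof -
  let ?b = "s * t + (s - 1)"
  have b: "?b < ns ! j" using cell_less[of t j "s - 1"] j s by simp
  have lt: "block_start ns j + ?b < n"
    using block_start_add_less[of j ns] b j by (simp_all add: n_def ns_def)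
  have jl: "j < length ns" using j by (simp add: ns_def)
  have bdiv: "?b div s = t" "?b mod s = s - 1"
    using div_mod_eq_iff[of "s - 1" s ?b t] s by (simp_all del: add_diff_assoc)
  have "col W (block_start ns j + ?b) = ?v - ?w"
  proof (rule eq_vecI)
    fix r assume "r < dim_vec (?v - ?w)"
    then have r: "r < n" by (simp add: e_def chain_sum_def)
    then obtain i a where ia: "i < length ns" "a < ns ! i" "r = block_start ns i + a"
      unfolding n_def by (rule block_coordinates)
    have i: "i < hd \<alpha>" using ia by (simp add: ns_def)
    have am: "a = s * (a div s) + a mod s" by simp
    have ms: "a mod s < s" using s by simp
    have entry: "W $$ (r, block_start ns j + ?b) =
       (if a div s \<noteq> t then 0 else if i = j then - coeff p (a mod s)
        else if j = Suc i \<and> a mod s = 0 then 1 else 0)"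
      using generalized_weyr_mat_index[of i \<alpha> a p j ?b, folded ns_def s_def W_def]
        i ia b j s ms bdiv
      by (simp add: companion_mat_def corner_mat_def Let_def flip: s_def)
    have w: "?w $ r = (if i = j \<and> a div s = t then coeff p (a mod s) else 0)"
    proof (cases "block_start ns j + s * t \<le> r \<and> r < block_start ns j + s * t + s")
      case True
      define d where "d = r - (block_start ns j + s * t)"
      have d: "d < s" "r = block_start ns j + (s * t + d)" using True by (auto simp: d_def)
      have "i = j \<and> a = s * t + d"
        using block_coordinates_eq_iff[OF ia(1,2) jl cell_less[OF j(2) d(1) j(1)]] ia(3) d(2)
        by simp
      then show ?thesis using True d r by (simp add: chain_sum_def)
    next
      case False
      have "\<not> (i = j \<and> a div s = t)"
      proof
        assume "i = j \<and> a div s = t"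
        then show False using False ia(3) am ms by auto
      qed
      then show ?thesis using False r by (auto simp: chain_sum_def)
    qed
    have v: "?v $ r = (if j = Suc i \<and> a = s * t then 1 else 0)"
    proof (cases j)
      case (Suc j')
      have "t < \<tau> ! j'"
        using j Suc \<tau>_antimono[of j'] by auto
      then have c: "s * t < ns ! j'" using cell_less[of t j' 0] s Suc j by simp
      have "r = block_start ns j' + s * t \<longleftrightarrow> i = j' \<and> a = s * t"
        using block_coordinates_eq_iff[OF ia(1,2), of j' "s * t"] c Suc jl ia(3) by simp
      moreover have "block_start ns j' + s * t < n"
        using block_start_add_less[of j' ns "s * t"] c Suc jl by (simp add: n_def)
      ultimately show ?thesis using Suc r by (auto simp: e_def)
    qed (use r in simp)
    have at: "a = s * t \<longleftrightarrow> a div s = t \<and> a mod s = 0"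
      using div_mod_eq_iff[OF s, of a t] by simp
    have "W $$ (r, block_start ns j + ?b) = ?v $ r - ?w $ r"
      unfolding entry v w at by auto
    then show "col W (block_start ns j + ?b) $ r = (?v - ?w) $ r"
      using W_carrier r lt by (simp add: chain_sum_def)
  qed (use W_carrier in \<open>simp add: chain_sum_def\<close>)
  then show ?thesis using mat_mult_unit_vec[OF W_carrier lt(1)] by (simp add: e_def)
qed

lemma pow_W_cell:
  assumes j: "j < hd \<alpha>" "t < \<tau> ! j" and "k < s"
  shows "W ^\<^sub>m k *\<^sub>v e (block_start ns j + s * t) = e (block_start ns j + (s * t + k))"
  using \<open>k < s\<close>
proof (induction k)
  case 0
  then show ?case using W_carrier by (simp add: e_def)
next
  case (Suc k)
  have Wk: "W ^\<^sub>m k \<in> carrier_mat n n" using W_carrier by simp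
  have "W ^\<^sub>m Suc k = W * W ^\<^sub>m k"
    using pow_mat_commute[OF W_carrier W_carrier refl] by simp
  then have "W ^\<^sub>m Suc k *\<^sub>v e (block_start ns j + s * t) =
      W *\<^sub>v (W ^\<^sub>m k *\<^sub>v e (block_start ns j + s * t))"
    using assoc_mult_mat_vec[OF W_carrier Wk] by (simp add: e_def)
  then show ?case using Suc W_shift[OF j, of k] by simp
qed

lemma poly_mat_upto_W_cell:
  assumes j: "j < hd \<alpha>" "t < \<tau> ! j" and "k \<le> s"
  shows "poly_mat_upto p W k *\<^sub>v e (block_start ns j + s * t) =
    chain_sum (block_start ns j + s * t) k"
  using \<open>k \<le> s\<close>
proof (induction k)
  case 0
  then show ?case using W_carrier by (intro eq_vecI) (auto simp: chain_sum_def e_def)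
next
  case (Suc k)
  let ?b = "block_start ns j + s * t"
  have Wk: "W ^\<^sub>m k \<in> carrier_mat n n" using W_carrier by simp
  have lt: "?b + k < n"
    using block_start_add_less[of j ns "s * t + k"] cell_less[of t j k] j Suc.prems
    by (simp add: n_def ns_def add_ac)
  have "poly_mat_upto p W (Suc k) *\<^sub>v e ?b =
      poly_mat_upto p W k *\<^sub>v e ?b + coeff p k \<cdot>\<^sub>v (W ^\<^sub>m k *\<^sub>v e ?b)"
    using W_carrier Wk by (simp add: add_mult_distrib_mat_vec[where nr=n and nc=n] e_def
      smult_mat_mult_vec[where m=n and n=n])
  also have "\<dots> = chain_sum ?b k + coeff p k \<cdot>\<^sub>v e (?b + k)"
    using Suc pow_W_cell[OF j, of k] by (simp add: add_ac)
  also have "\<dots> = chain_sum ?b (Suc k)"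
    using lt by (intro eq_vecI) (auto simp: chain_sum_def e_def)
  finally show ?case .
qed

text \<open>
  As \<open>p\<close> is monic, the top power contributes \<open>W^s e\<close> with coefficient 1, and its companion part
  cancels the sum of all lower terms. Only the jump into the previous block survives.
\<close>

lemma poly_mat_W_cell:
  assumes p: "lead_coeff p = 1" and j: "j < hd \<alpha>" "t < \<tau> ! j" and s: "s > 0"
  shows "poly_mat p W *\<^sub>v e (block_start ns j + s * t) =
    (if j = 0 then 0\<^sub>v n else e (block_start ns (j - 1) + s * t))" (is "_ = ?v")
proof -
  let ?b = "block_start ns j + s * t"
  have Ws: "W ^\<^sub>m (s - 1) \<in> carrier_mat n n" "W ^\<^sub>m s \<in> carrier_mat n n"
    using W_carrier by simp_all
  have "W ^\<^sub>m s = W ^\<^sub>m Suc (s - 1)" using s by simp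
  also have "\<dots> = W * W ^\<^sub>m (s - 1)"
    using pow_mat_commute[OF W_carrier W_carrier refl] by simp
  finally have "W ^\<^sub>m s *\<^sub>v e ?b = W *\<^sub>v (W ^\<^sub>m (s - 1) *\<^sub>v e ?b)"
    using assoc_mult_mat_vec[OF W_carrier Ws(1)] by (simp add: e_def)
  also have "\<dots> = ?v - chain_sum ?b s"
    using pow_W_cell[OF j, of "s - 1"] W_wrap[OF j s] s by simp
  finally have pow: "W ^\<^sub>m s *\<^sub>v e ?b = ?v - chain_sum ?b s" .
  have "poly_mat p W *\<^sub>v e ?b = poly_mat_upto p W s *\<^sub>v e ?b + W ^\<^sub>m s *\<^sub>v e ?b"
    using W_carrier Ws p unfolding poly_mat_def
    by (simp add: add_mult_distrib_mat_vec[where nr=n and nc=n] e_def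
      smult_mat_mult_vec[where m=n and n=n] flip: s_def)
  also have "\<dots> = chain_sum ?b s + (?v - chain_sum ?b s)"
    using pow poly_mat_upto_W_cell[OF j order_refl] by simp
  also have "\<dots> = ?v"
    by (intro eq_vecI) (auto simp: chain_sum_def e_def)
  finally show ?thesis .
qed

text \<open>
  Every basis vector of a cell is \<open>W^k\<close> applied to the first one, and \<open>p(W)\<close> commutes with \<open>W^k\<close>.
\<close>

lemma col_poly_mat_W:
  assumes p: "lead_coeff p = 1" and j: "j < hd \<alpha>" "b < ns ! j"
  shows "col (poly_mat p W) (block_start ns j + b) =
    (if j = 0 then 0\<^sub>v n else e (block_start ns (j - 1) + b))"
proof -
  define t k where "t = b div s" and "k = b mod s"
  have "b < s * \<tau> ! j" using j by (simp add: ns_def s_def \<tau>_def)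
  then have s: "s > 0" by (cases s) auto
  have k: "k < s" and b: "b = s * t + k" using s by (simp_all add: t_def k_def)
  have t: "t < \<tau> ! j"
    using \<open>b < s * \<tau> ! j\<close> by (simp add: t_def less_mult_imp_div_less mult.commute)
  have P: "poly_mat p W \<in> carrier_mat n n" and Wk: "W ^\<^sub>m k \<in> carrier_mat n n"
    using W_carrier by simp_all
  have PW: "poly_mat p W * W ^\<^sub>m k = W ^\<^sub>m k * poly_mat p W"
    using pow_mat_commute[OF W_carrier P] poly_mat_commute[OF W_carrier W_carrier refl] by metis
  have "block_start ns j + b < n"
    using block_start_add_less[of j ns b] j by (simp add: n_def ns_def)
  then have "col (poly_mat p W) (block_start ns j + b) =
      poly_mat p W *\<^sub>v (W ^\<^sub>m k *\<^sub>v e (block_start ns j + s * t))"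
    using mat_mult_unit_vec[OF P] pow_W_cell[OF j(1) t k] by (simp add: e_def b)
  also have "\<dots> = W ^\<^sub>m k *\<^sub>v (poly_mat p W *\<^sub>v e (block_start ns j + s * t))"
    using assoc_mult_mat_vec[OF P Wk] assoc_mult_mat_vec[OF Wk P] PW by (simp add: e_def)
  also have "\<dots> = W ^\<^sub>m k *\<^sub>v (if j = 0 then 0\<^sub>v n else e (block_start ns (j - 1) + s * t))"
    using poly_mat_W_cell[OF p j(1) t s] by simp
  also have "\<dots> = (if j = 0 then 0\<^sub>v n else e (block_start ns (j - 1) + b))"
  proof (cases j)
    case 0
    then show ?thesis using Wk by (intro eq_vecI) (auto simp: scalar_prod_def)
  next
    case (Suc j')
    have "t < \<tau> ! j'" using t j Suc \<tau>_antimono[of j'] by auto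
    then show ?thesis using pow_W_cell[of j' t k] k j Suc by (simp add: b)
  qed
  finally show ?thesis .
qed

lemma poly_mat_W_index:
  assumes p: "lead_coeff p = 1" and j: "j < hd \<alpha>" "b < ns ! j" and i: "i < hd \<alpha>" "a < ns ! i"
  shows "poly_mat p W $$ (block_start ns i + a, block_start ns j + b) =
    (if j = Suc i \<and> a = b then 1 else 0)"
proof -
  have lt: "block_start ns j + b < n" "block_start ns i + a < n"
    using block_start_add_less[of j ns b] block_start_add_less[of i ns a] i j
    by (simp_all add: n_def ns_def)
  have "poly_mat p W $$ (block_start ns i + a, block_start ns j + b) =
    (if j = 0 then 0\<^sub>v n else e (block_start ns (j - 1) + b)) $ (block_start ns i + a)"
    using lt poly_mat_carrier[OF W_carrier, of p] unfolding col_poly_mat_W[OF p j, symmetric]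
    by simp
  also have "\<dots> = (if j = Suc i \<and> a = b then 1 else 0)"
  proof (cases j)
    case (Suc j')
    have "b < ns ! j'"
      using j Suc ns_antimono[of j'] by auto
    then have "block_start ns i + a = block_start ns j' + b \<longleftrightarrow> i = j' \<and> a = b"
      "block_start ns j' + b < n"
      using block_coordinates_eq_iff[of i ns a j' b] block_start_add_less[of j' ns b] i j Suc
      by (simp_all add: ns_def n_def)
    then show ?thesis using Suc lt by (auto simp: e_def)
  qed (use lt in simp)
  finally show ?thesis .
qed

section \<open>Matrices commuting with the generalized Weyr matrix\<close>

text \<open>
  Multiplying \<open>K\<close> by \<open>p(W)\<close> from the left moves its block rows up, multiplying from the right moves
  its block columns to the right, and block column 0 of the latter product is zero.
\<close>

lemma commute_W_shift:
  assumes p: "lead_coeff p = 1" and K: "K \<in> carrier_mat n n" and WK: "W * K = K * W"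
    and i: "Suc i < hd \<alpha>" "a < ns ! Suc i" and j: "j < hd \<alpha>" "b < ns ! j"
  shows "K $$ (block_start ns (Suc i) + a, block_start ns j + b) =
    (if j = 0 then 0 else K $$ (block_start ns i + a, block_start ns (j - 1) + b))"
proof -
  let ?P = "poly_mat p W"
  have P: "?P \<in> carrier_mat n n" using W_carrier by simp
  have PK: "?P * K = K * ?P" using poly_mat_commute[OF W_carrier K WK] .
  have a: "a < ns ! i"
    using i ns_antimono[of i] by simp
  define x y z where "x = block_start ns i + a" and "y = block_start ns j + b"
    and "z = block_start ns (Suc i) + a"
  have xyz: "x < n" "y < n" "z < n"
    using i j a block_start_add_less[of i ns a] block_start_add_less[of j ns b]
      block_start_add_less[of "Suc i" ns a]
    by (simp_all add: ns_def n_def x_def y_def z_def)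
  have "row ?P x = e z"
  proof (rule eq_vecI)
    fix r assume "r < dim_vec (e z)"
    then have r: "r < n" by (simp add: e_def)
    then obtain j' b' where jb: "j' < length ns" "b' < ns ! j'" "r = block_start ns j' + b'"
      unfolding n_def by (rule block_coordinates)
    have "?P $$ (x, r) = (if j' = Suc i \<and> a = b' then 1 else 0)"
      using poly_mat_W_index[OF p, of j' b' i a] i a jb by (simp add: ns_def x_def)
    also have "\<dots> = e z $ r"
      using block_coordinates_eq_iff[of j' ns b' "Suc i" a] jb i r xyz
      by (auto simp: z_def e_def ns_def)
    finally show "row ?P x $ r = e z $ r" using P xyz r by simp
  qed (use P in \<open>simp add: e_def\<close>)
  then have "(?P * K) $$ (x, y) = K $$ (z, y)"
    using P K xyz by (simp add: e_def scalar_prod_left_unit)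
  moreover have "(K * ?P) $$ (x, y) =
      (if j = 0 then 0 else K $$ (x, block_start ns (j - 1) + b))"
  proof (cases j)
    case 0
    then show ?thesis using col_poly_mat_W[OF p j] P K xyz by (simp add: y_def)
  next
    case (Suc j')
    have "b < ns ! j'"
      using j Suc ns_antimono[of j'] by auto
    then have "block_start ns j' + b < n"
      using block_start_add_less[of j' ns b] j Suc by (simp add: ns_def n_def)
    then show ?thesis
      using col_poly_mat_W[OF p j] P K xyz Suc by (simp add: y_def e_def scalar_prod_right_unit)
  qed
  ultimately show ?thesis using PK by (simp add: x_def y_def z_def)
qed

text \<open>
  The shift relation preserves \<open>i - j > 0\<close>, so each step stays strictly below the diagonal, and
  because block sizes never increase the inner position \<open>(a, b)\<close> exists in every block that is visited.
\<close>

lemma commute_W_lower_zero: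
  assumes p: "lead_coeff p = 1" and K: "K \<in> carrier_mat n n" and WK: "W * K = K * W"
    and "j < i" "i < hd \<alpha>" "a < ns ! i" "b < ns ! j"
  shows "K $$ (block_start ns i + a, block_start ns j + b) = 0"
  using assms(4-)
proof (induction j arbitrary: i)
  case 0
  then obtain i' where "i = Suc i'" by (cases i) auto
  then show ?case using commute_W_shift[OF p K WK, of i' a 0 b] 0 by simp
next
  case (Suc j)
  obtain i' where i': "i = Suc i'" using Suc.prems by (cases i) auto
  have "b < ns ! j" "a < ns ! i'"
    using ns_antimono[of j] ns_antimono[of i'] Suc.prems i' by simp_all
  then have "K $$ (block_start ns i' + a, block_start ns j + b) = 0"
    using Suc.IH[of i'] Suc.prems i' by simp
  then show ?case using commute_W_shift[OF p K WK, of i' a "Suc j" b] Suc.prems i' by simp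
qed

end

theorem mainTheorem6:
  fixes p :: "'a::field poly" and s :: nat and \<alpha> \<tau> :: "nat list" and W K :: "'a mat"
    and K_block :: "nat \<Rightarrow> nat \<Rightarrow> 'a mat"
  assumes "lead_coeff p = 1" and "irreducible p" and "degree p = s"
    and "segre_characteristic \<alpha>"
    and "\<tau> = conjugate_partition \<alpha>"
    and "W = generalized_weyr_mat p \<alpha>"
    and "K \<in> centralizer W"
    and "K_block = get_block (map (\<lambda>t. s * t) \<tau>) K"
  shows "(\<forall>i<hd \<alpha>. \<forall>j<i. K_block i j = 0\<^sub>m (s * \<tau> ! i) (s * \<tau> ! j)) \<and>
    det K = (\<Prod>i<hd \<alpha>. det (K_block i i))"
proof -
  let ?ns = "weyr_block_sizes p \<alpha>"
  have blk: "K_block = get_block ?ns K"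
    using assms by (simp add: weyr_block_sizes_def)
  have K: "K \<in> carrier_mat (sum_list ?ns) (sum_list ?ns)" and WK: "W * K = K * W"
    using assms(6,7) by (simp_all add: centralizer_def generalized_weyr_mat_def mat_of_blocks_def)
  have zero: "K_block i j = 0\<^sub>m (?ns ! i) (?ns ! j)" if "i < hd \<alpha>" "j < i" for i j
    using commute_W_lower_zero[OF assms(1) K WK[unfolded assms(6)] that(2,1)]
    by (intro eq_matI) (simp_all add: blk get_block_def)
  then have "det K = (\<Prod>i<hd \<alpha>. det (K_block i i))"
    using det_block_upper_triangular[OF K] by (simp add: blk)
  then show ?thesis
    using zero assms(3,5) by simp
qed

end
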